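(* Let $p\in\{1,2\}$ and let $G_2$ be the spider graph consisting of a center $v_0$ and three legs $v_0x_1x_2\cdots x_p$, $v_0y_1y_2\cdots y_p$, $v_0z_1z_2\cdots z_p$ (paths with $p$ vertices each besides $v_0$); write $x_0=y_0=z_0=v_0$. Let $H_1,\dots,H_{3p}$ be connected graphs, each with at least two vertices, with $m_i=|V(H_i)|$ ordered so that $m_1\le m_2\le\dots\le m_{3p}$. Let $\Gamma=G_2\diamond(H_1,\dots,H_{3p})$ be the generalized edge corona in which, for each $k\in\{0,1,\dots,p-1\}$, every vertex of $H_{3k+1}$ is joined to $x_{p-k}$ and $x_{p-k-1}$, every vertex of $H_{3k+2}$ is joined to $y_{p-k}$ and $y_{p-k-1}$, and every vertex of $H_{3k+3}$ is joined to $z_{p-k}$ and $z_{p-k-1}$. Then: (1) if $p=1$, $\Gamma$ is antimagic; (2) if $p=2$ and $\Delta(H_i)\le\delta(H_{i+1})$ for all $i\in\{1,\dots,5\}$, $d'(x_2)\le\delta'(H_2)$, $d'(y_2)\le\delta'(H_3)$ and $d'(z_2)\le\delta'(H_4)$, then $\Gamma$ is antimagic.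
   Context: All graphs are simple and undirected. A graph $G$ is antimagic if there is a bijection $f:E(G)\to\{1,2,\dots,|E(G)|\}$ such that the vertex sums $w(v)=\sum_{e\ni v}f(e)$ are pairwise distinct over all vertices $v$. For a graph $G$ with $m$ edges $e_1,\dots,e_m$ and graphs $H_1,\dots,H_m$, the generalized edge corona $G\diamond(H_1,\dots,H_m)$ is obtained from disjoint copies of $G,H_1,\dots,H_m$ by joining both end vertices of $e_i$ to every vertex of $H_i$, for each $i$. $\Delta(H)$ and $\delta(H)$ denote the maximum and minimum degree of $H$ itself. For a vertex $v$ of $\Gamma$, $d'(v)$ denotes its degree in $\Gamma$; $\delta'(H_i)$ denotes the minimum of $d'(v)$ over $v\in V(H_i)$ (so $d'(v)=\deg_{H_i}(v)+2$ for $v\in V(H_i)$). *)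

theory Defs
  imports Main
begin

definition simple_graph :: "'v set \<Rightarrow> 'v set set \<Rightarrow> bool" where
  "simple_graph V E \<longleftrightarrow> finite V \<and>
     (\<forall>e\<in>E. \<exists>u v. e = {u, v} \<and> u \<in> V \<and> v \<in> V \<and> u \<noteq> v)"

definition connected_graph :: "'v set \<Rightarrow> 'v set set \<Rightarrow> bool" where
  "connected_graph V E \<longleftrightarrow> V \<noteq> {} \<and>
     (\<forall>u\<in>V. \<forall>v\<in>V. (\<lambda>a b. {a, b} \<in> E)\<^sup>*\<^sup>* u v)"

definition degree :: "'v set set \<Rightarrow> 'v \<Rightarrow> nat" where
  "degree E v = card {e \<in> E. v \<in> e}"

definition max_degree :: "'v set \<Rightarrow> 'v set set \<Rightarrow> nat" where
  "max_degree V E = Max (degree E ` V)"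

definition min_degree :: "'v set \<Rightarrow> 'v set set \<Rightarrow> nat" where
  "min_degree V E = Min (degree E ` V)"

definition vertex_sum :: "'v set set \<Rightarrow> ('v set \<Rightarrow> nat) \<Rightarrow> 'v \<Rightarrow> nat" where
  "vertex_sum E f v = (\<Sum>e\<in>{e \<in> E. v \<in> e}. f e)"

definition antimagic :: "'v set \<Rightarrow> 'v set set \<Rightarrow> bool" where
  "antimagic V E \<longleftrightarrow> (\<exists>f. bij_betw f E {1..card E} \<and> inj_on (vertex_sum E f) V)"

text \<open>Generalized edge corona G \<diamond> (H_1,...,H_m). The edges of G are enumerated as
  ed 1, ..., ed m; copy i of H_i lives on vertices Inr (i, a).\<close>

definition corona_V :: "'v set \<Rightarrow> nat \<Rightarrow> (nat \<Rightarrow> 'a set) \<Rightarrow> ('v + nat \<times> 'a) set" where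
  "corona_V VG m VH = Inl ` VG \<union> {Inr (i, a) | i a. i \<in> {1..m} \<and> a \<in> VH i}"

definition corona_E :: "'v set set \<Rightarrow> (nat \<Rightarrow> 'v set) \<Rightarrow> nat \<Rightarrow> (nat \<Rightarrow> 'a set)
    \<Rightarrow> (nat \<Rightarrow> 'a set set) \<Rightarrow> ('v + nat \<times> 'a) set set" where
  "corona_E EG ed m VH EH =
     (\<lambda>e. Inl ` e) ` EG
     \<union> (\<Union>i\<in>{1..m}. (\<lambda>e. (\<lambda>a. Inr (i, a)) ` e) ` EH i)
     \<union> {{Inl u, Inr (i, a)} | u i a. i \<in> {1..m} \<and> u \<in> ed i \<and> a \<in> VH i}"

text \<open>Spider with three legs of length p. Vertices are pairs (l, j); the centre is (0,0);
  leg l \<in> {0,1,2} (x, y, z) has vertices (l,1),...,(l,p).\<close>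

definition spider_pt :: "nat \<Rightarrow> nat \<Rightarrow> nat \<times> nat" where
  "spider_pt l j = (if j = 0 then (0, 0) else (l, j))"

definition spider_V :: "nat \<Rightarrow> (nat \<times> nat) set" where
  "spider_V p = {(0, 0)} \<union> {(l, j) | l j. l < 3 \<and> 1 \<le> j \<and> j \<le> p}"

definition spider_E :: "nat \<Rightarrow> (nat \<times> nat) set set" where
  "spider_E p = {{spider_pt l j, spider_pt l (Suc j)} | l j. l < 3 \<and> j < p}"

definition spider_ed :: "nat \<Rightarrow> nat \<Rightarrow> (nat \<times> nat) set" where
  "spider_ed p i = (let k = (i - 1) div 3; l = (i - 1) mod 3 in
      {spider_pt l (p - k), spider_pt l (p - k - 1)})"

abbreviation Gamma_V :: "nat \<Rightarrow> (nat \<Rightarrow> 'a set) \<Rightarrow> (nat \<times> nat + nat \<times> 'a) set" where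
  "Gamma_V p VH \<equiv> corona_V (spider_V p) (3 * p) VH"

abbreviation Gamma_E :: "nat \<Rightarrow> (nat \<Rightarrow> 'a set) \<Rightarrow> (nat \<Rightarrow> 'a set set)
    \<Rightarrow> (nat \<times> nat + nat \<times> 'a) set set" where
  "Gamma_E p VH EH \<equiv> corona_E (spider_E p) (spider_ed p) (3 * p) VH EH"

end

theory Submission
  imports Defs
begin

text \<open>Choose pivot vertices \<open>t\<^sub>0, t\<^sub>1, \<dots>\<close> and attach to each a group of its neighbours, so that groups and
  pivots exhaust the graph. Edges are labelled in the order: edges meeting the group of \<open>t\<^sub>0\<close> but no
  pivot, edges at \<open>t\<^sub>0\<close>, edges meeting the group of \<open>t\<^sub>1\<close> but no pivot, edges at \<open>t\<^sub>1\<close>, and so on, where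
  the edges at a pivot are sorted by the sums their other ends have collected so far. Within a
  group the sums are then distinct; a pivot beats its group and is beaten by the next group by
  comparing degrees, because the labels involved dominate each other after cancelling the common
  edge. For \<open>p = 1\<close> the centre is adjacent to everything and is the only pivot; for \<open>p = 2\<close> the pivots
  are \<open>x\<^sub>2, y\<^sub>2, z\<^sub>2, v\<^sub>0\<close> with groups \<open>H\<^sub>1, H\<^sub>2, H\<^sub>3\<close> and \<open>H\<^sub>4 \<union> H\<^sub>5 \<union> H\<^sub>6 \<union> {x\<^sub>1, y\<^sub>1, z\<^sub>1}\<close>. The vertices
  \<open>x\<^sub>1, y\<^sub>1, z\<^sub>1\<close> have edges of low rank, but their \<open>m\<^sub>4 + 1\<close>, \<open>m\<^sub>5 + 1\<close>, \<open>m\<^sub>6 + 1\<close> edges of high rank already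
  outweigh the \<open>m\<^sub>3 + 1\<close> edges at \<open>z\<^sub>2\<close>.\<close>

subsection \<open>Greedy labellings and pivots\<close>

lemma simple_graph_edgeE:
  assumes "simple_graph V E" "e \<in> E"
  obtains u v where "e = {u, v}" "u \<in> V" "v \<in> V" "u \<noteq> v"
  using assms unfolding simple_graph_def by blast

lemma finite_edges:
  assumes "simple_graph V E"
  shows "finite E"
proof -
  have "E \<subseteq> Pow V" by (auto elim: simple_graph_edgeE[OF assms])
  then show ?thesis using assms by (auto simp: simple_graph_def intro: finite_subset)
qed

lemma degree_less_card:
  assumes simple: "simple_graph V E" and v: "v \<in> V"
  shows "degree E v < card V"
proof -
  have fin: "finite V" using simple by (simp add: simple_graph_def)
  have "{e \<in> E. v \<in> e} \<subseteq> (\<lambda>u. {v, u}) ` (V - {v})"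
  proof
    fix e assume e: "e \<in> {e \<in> E. v \<in> e}"
    then obtain a b where "e = {a, b}" "a \<in> V" "b \<in> V" "a \<noteq> b"
      using simple_graph_edgeE[OF simple] by blast
    with e show "e \<in> (\<lambda>u. {v, u}) ` (V - {v})" by auto
  qed
  then have "degree E v \<le> card ((\<lambda>u. {v, u}) ` (V - {v}))"
    unfolding degree_def using fin by (intro card_mono) auto
  also have "\<dots> \<le> card (V - {v})" using fin by (intro card_image_le) auto
  also have "\<dots> < card V" using fin v by (intro card_Diff1_less)
  finally show ?thesis .
qed

text \<open>Induction adds the elements in nondecreasing order of \<open>g\<close>, so the new one
  can take the last number. The ranking induction allows the inserted element to be present already,
  hence the case split.\<close>

lemma exists_sorting_enumeration:
  fixes g :: "'e \<Rightarrow> nat"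
  assumes "finite K"
  shows "\<exists>h. bij_betw h K {1..card K} \<and> (\<forall>e\<in>K. \<forall>e'\<in>K. h e < h e' \<longrightarrow> g e \<le> g e')"
  using assms
proof (induction K rule: finite_ranking_induct[where f = g])
  case empty
  show ?case by (auto simp: bij_betw_def)
next
  case (insert x S)
  show ?case
  proof (cases "x \<in> S")
    case True
    with insert show ?thesis by (simp add: insert_absorb)
  next
    case False
    obtain h where h: "bij_betw h S {1..card S}" "\<forall>e\<in>S. \<forall>e'\<in>S. h e < h e' \<longrightarrow> g e \<le> g e'"
      using insert.IH by blast
    let ?h = "h(x := Suc (card S))"
    have "bij_betw ?h S {1..card S}"
      using h(1) False by (auto simp: bij_betw_def inj_on_def image_iff)
    then have "bij_betw ?h (S \<union> {x}) ({1..card S} \<union> {Suc (card S)})"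
      using False notIn_Un_bij_betw[of x S ?h "{1..card S}"] by simp
    moreover have "{1..card S} \<union> {Suc (card S)} = {1..card (insert x S)}"
      using insert.hyps False by auto
    ultimately have "bij_betw ?h (insert x S) {1..card (insert x S)}" by simp
    moreover have "g e \<le> g e'"
      if "e \<in> insert x S" "e' \<in> insert x S" "?h e < ?h e'" for e e'
    proof -
      have "\<not> Suc (card S) < h a" if "a \<in> S" for a
        using bij_betwE[OF h(1)] that by fastforce
      then show ?thesis using that h(2) insert.hyps False
        by (auto split: if_splits)
    qed
    ultimately show ?thesis by blast
  qed
qed

text \<open>Levels of constant rank receive consecutive blocks of labels. Since \<open>N e\<close>
  contains only elements of strictly lower rank, \<open>sum f (N e)\<close> is settled before the
  level of \<open>e\<close> is reached and can serve as the sorting key there.\<close>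

lemma exists_greedy_labelling:
  fixes r :: "'e \<Rightarrow> nat" and N :: "'e \<Rightarrow> 'e set"
  assumes fin: "finite E"
    and N: "\<And>e e'. e \<in> E \<Longrightarrow> e' \<in> N e \<Longrightarrow> e' \<in> E \<and> r e' < r e"
  obtains f where "bij_betw f E {1..card E}"
    and "\<And>e e'. e \<in> E \<Longrightarrow> e' \<in> E \<Longrightarrow> r e < r e' \<Longrightarrow> f e < f e'"
    and "\<And>e e'. e \<in> E \<Longrightarrow> e' \<in> E \<Longrightarrow> r e = r e' \<Longrightarrow> f e < f e' \<Longrightarrow> sum f (N e) \<le> sum f (N e')"
proof -
  let ?P = "\<lambda>A f. bij_betw f A {1..card A}
      \<and> (\<forall>e\<in>A. \<forall>e'\<in>A. r e < r e' \<longrightarrow> f e < f e')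
      \<and> (\<forall>e\<in>A. \<forall>e'\<in>A. r e = r e' \<and> f e < f e' \<longrightarrow> sum f (N e) \<le> sum f (N e'))"
  have step: "\<exists>f. ?P {e \<in> E. r e < n} f" for n
  proof (induction n)
    case 0
    show ?case by (auto simp: bij_betw_def)
  next
    case (Suc n)
    let ?A = "{e \<in> E. r e < n}" and ?K = "{e \<in> E. r e = n}" and ?B = "{e \<in> E. r e < Suc n}"
    from Suc obtain f where f: "?P ?A f" by blast
    have "finite ?K" using fin by simp
    from exists_sorting_enumeration[OF this, of "\<lambda>e. sum f (N e)"]
    obtain h where h: "bij_betw h ?K {1..card ?K}"
        "\<forall>e\<in>?K. \<forall>e'\<in>?K. h e < h e' \<longrightarrow> sum f (N e) \<le> sum f (N e')"
      by blast
    define f' where "f' = (\<lambda>e. if r e < n then f e else card ?A + h e)"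
    have fA: "f e \<in> {1..card ?A}" if "e \<in> ?A" for e
      using f that by (auto dest: bij_betwE)
    have hK: "h e \<in> {1..card ?K}" if "e \<in> ?K" for e
      using h(1) that by (auto dest: bij_betwE)
    \<comment> \<open>Elements of \<open>N e\<close> have rank below \<open>n\<close>, where
      \<open>f'\<close> and \<open>f\<close> agree, so labelling level \<open>n\<close> changes no
      sorting key up to that level.\<close>
    have sums: "sum f' (N e) = sum f (N e)" if "e \<in> ?B" for e
      using N that by (intro sum.cong) (force simp: f'_def)+
    have B: "?B = ?A \<union> ?K" by auto
    have "card ?B = card ?A + card ?K"
      unfolding B using fin by (intro card_Un_disjoint) auto
    then have img: "{1..card ?B} = {1..card ?A} \<union> {card ?A + 1..card ?A + card ?K}" by auto
    have "bij_betw f' ?A {1..card ?A}"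
      using f by (subst bij_betw_cong[of _ _ f]) (auto simp: f'_def)
    moreover have "bij_betw f' ?K {card ?A + 1..card ?A + card ?K}"
    proof -
      have "bij_betw ((+) (card ?A)) {1..card ?K} {card ?A + 1..card ?A + card ?K}"
        by (auto simp: bij_betw_def)
      from bij_betw_trans[OF h(1) this] show ?thesis
        by (subst bij_betw_cong[of _ _ "(+) (card ?A) \<circ> h"]) (auto simp: f'_def)
    qed
    ultimately have "bij_betw f' ?B {1..card ?B}"
      unfolding img unfolding B by (rule bij_betw_combine) auto
    moreover have "f' e < f' e'" if "e \<in> ?B" "e' \<in> ?B" "r e < r e'" for e e'
    proof (cases "r e' < n")
      case True
      then show ?thesis using f that by (auto simp: f'_def)
    next
      case False
      then show ?thesis using fA[of e] hK[of e'] that by (auto simp: f'_def)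
    qed
    moreover have "sum f' (N e) \<le> sum f' (N e')"
      if "e \<in> ?B" "e' \<in> ?B" "r e = r e'" "f' e < f' e'" for e e'
      unfolding sums[OF that(1)] sums[OF that(2)]
      using f h(2) that by (cases "r e < n") (auto simp: f'_def)
    ultimately show ?case by blast
  qed
  \<comment> \<open>One step past the largest rank covers all of \<open>E\<close>; if
    \<open>E\<close> is empty, both sides are empty whatever value \<open>Max\<close> takes.\<close>
  have "{e \<in> E. r e < Suc (Max (r ` E))} = E"
    using fin by (auto simp: less_Suc_eq_le)
  with step[of "Suc (Max (r ` E))"] obtain f where "?P E f" by auto
  then show thesis by (intro that[of f]) auto
qed

text \<open>Common elements cancel. What remains of \<open>B\<close> is nonempty and at least as
  numerous as what remains of \<open>A\<close>, and its values are larger. This turns comparisons of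
  degrees into comparisons of vertex sums.\<close>

lemma sum_less_of_card_le:
  fixes f :: "'e \<Rightarrow> nat"
  assumes fin: "finite A" "finite B" and card: "card A \<le> card B" and ne: "A \<noteq> B"
    and pos: "\<And>b. b \<in> B \<Longrightarrow> 0 < f b"
    and less: "\<And>a b. a \<in> A - B \<Longrightarrow> b \<in> B - A \<Longrightarrow> f a < f b"
  shows "sum f A < sum f B"
proof -
  have cd: "card (A - B) \<le> card (B - A)"
    using card fin by (metis Diff_Int2 Int_commute card_Diff_subset_Int diff_le_mono finite_Int inf.idem)
  have ne': "B - A \<noteq> {}"
    using card fin ne by (metis Diff_eq_empty_iff card_seteq)
  \<comment> \<open>A threshold: at most every value left in \<open>B\<close> and strictly above
    every value left in \<open>A\<close>.\<close>
  define c where "c = Min (f ` (B - A))"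
  have cB: "c \<le> f b" if "b \<in> B - A" for b
    using fin that by (auto simp: c_def)
  have "c \<in> f ` (B - A)" unfolding c_def using fin ne' by (intro Min_in) auto
  then have cA: "f a < c" if "a \<in> A - B" for a
    using less that by auto
  have "sum f (A - B) < sum f (B - A)"
  proof (cases "A - B = {}")
    case True
    have "0 < sum f (B - A)" using fin ne' pos by (intro sum_pos) auto
    then show ?thesis unfolding True by simp
  next
    case False
    have "sum f (A - B) < (\<Sum>a\<in>A - B. c)"
      using False fin cA by (intro sum_strict_mono) auto
    also have "\<dots> \<le> (\<Sum>b\<in>B - A. c)" using cd by simp
    also have "\<dots> \<le> sum f (B - A)" using cB by (intro sum_mono) auto
    finally show ?thesis .
  qed
  moreover have "sum f A = sum f (A \<inter> B) + sum f (A - B)" "sum f B = sum f (A \<inter> B) + sum f (B - A)"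
    using fin by (metis sum.Int_Diff, metis sum.Int_Diff Int_commute)
  ultimately show ?thesis by simp
qed


text \<open>The vertex sums increase along \<open>S 0, t 0, S 1, t 1, \<dots>\<close>. The pivot edges of a group share one
  rank, so the greedy labelling sorts them by the partial sums of their other ends, which keeps
  the sums inside a group distinct.\<close>

lemma antimagic_of_pivots:
  fixes t :: "nat \<Rightarrow> 'v" and S :: "nat \<Rightarrow> 'v set" and r :: "'v set \<Rightarrow> nat"
  assumes simple: "simple_graph V E"
    and V: "V = (\<Union>j<k. insert (t j) (S j))"
    and S_nonempty: "\<And>j. j < k \<Longrightarrow> S j \<noteq> {}"
    and adjacent: "\<And>j u. j < k \<Longrightarrow> u \<in> S j \<Longrightarrow> {u, t j} \<in> E"
    and rank_pivot: "\<And>j e. j < k \<Longrightarrow> e \<in> E \<Longrightarrow> t j \<in> e \<longleftrightarrow> r e = 2 * j + 1"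
    and rank_group: "\<And>j u e. j < k \<Longrightarrow> u \<in> S j \<Longrightarrow> e \<in> E \<Longrightarrow> u \<in> e \<Longrightarrow> t j \<notin> e \<Longrightarrow> r e \<le> 2 * j"
    and degree_pivot: "\<And>j. j < k \<Longrightarrow> 1 < degree E (t j)"
    and degree_group: "\<And>j u. j < k \<Longrightarrow> u \<in> S j \<Longrightarrow> degree E u \<le> degree E (t j)"
    and degree_next: "\<And>j u. Suc j < k \<Longrightarrow> u \<in> S (Suc j) \<Longrightarrow>
      degree E (t j) \<le> card {e \<in> E. u \<in> e \<and> 2 * j + 1 < r e}"
  shows "antimagic V E"
proof -
  have edgeE: "\<exists>a b. e = {a, b} \<and> a \<in> V \<and> b \<in> V \<and> a \<noteq> b" if "e \<in> E" for e
    using simple_graph_edgeE[OF simple that] by blast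
  have fin: "finite E" using finite_edges[OF simple] .
  \<comment> \<open>For a pivot edge \<open>{u, t j}\<close> with \<open>u\<close> in
    \<open>S j\<close>, all edges at \<open>t j\<close> share one rank, so this set is exactly the
    set of other edges at \<open>u\<close>. The sorting key is then the part of the sum at
    \<open>u\<close> labelled earlier.\<close>
  define N where "N = (\<lambda>e. {e' \<in> E. r e' < r e \<and> e' \<inter> e \<noteq> {}})"
  have N: "e' \<in> E \<and> r e' < r e" if "e' \<in> N e" for e e'
    using that by (simp add: N_def)
  obtain f where bij: "bij_betw f E {1..card E}"
    and rank: "\<And>e e'. e \<in> E \<Longrightarrow> e' \<in> E \<Longrightarrow> r e < r e' \<Longrightarrow> f e < f e'"
    and sorted: "\<And>e e'. e \<in> E \<Longrightarrow> e' \<in> E \<Longrightarrow> r e = r e' \<Longrightarrow> f e < f e' \<Longrightarrow> sum f (N e) \<le> sum f (N e')"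
    using exists_greedy_labelling[OF fin, of N r, OF N] by blast
  have pos: "0 < f e" if "e \<in> E" for e
    using bij_betwE[OF bij] that by auto
  let ?I = "\<lambda>v. {e \<in> E. v \<in> e}"
  let ?w = "vertex_sum E f"
  have key: "e = {u, t j}" if "j < k" "u \<in> S j" "e \<in> E" "u \<in> e" "t j \<in> e" for j u e
    using edgeE[OF that(3)] edgeE[OF adjacent[OF that(1,2)]] that(4,5)
    by (auto simp: doubleton_eq_iff)
  have neq: "u \<noteq> t j" if "j < k" "u \<in> S j" for j u
    using edgeE[OF adjacent[OF that]] by (auto simp: doubleton_eq_iff)
  \<comment> \<open>Only \<open>{u, t j}\<close> is shared. The other edges at \<open>u\<close> have
    rank at most \<open>2 * j\<close>, those at \<open>t j\<close> have rank
    \<open>2 * j + 1\<close>, so the degree comparison decides.\<close>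
  have S_less: "?w u < ?w (t j)" if j: "j < k" and u: "u \<in> S j" for j u
    unfolding vertex_sum_def
  proof (rule sum_less_of_card_le)
    show "card (?I u) \<le> card (?I (t j))"
      using degree_group[OF j u] by (simp add: degree_def)
    show "?I u \<noteq> ?I (t j)"
    proof
      \<comment> \<open>Equality would leave the pivot with a single edge.\<close>
      assume "?I u = ?I (t j)"
      then have "?I (t j) \<subseteq> {{u, t j}}" using key[OF j u] by blast
      then have "card (?I (t j)) \<le> card {{u, t j}}" by (intro card_mono) auto
      then show False using degree_pivot[OF j] by (simp add: degree_def)
    qed
    fix a b assume "a \<in> ?I u - ?I (t j)" "b \<in> ?I (t j) - ?I u"
    then show "f a < f b"
      using rank_group[OF j u, of a] rank_pivot[OF j, of b] by (intro rank) auto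
  qed (use fin pos in auto)
  \<comment> \<open>The edges at \<open>u\<close> of rank above \<open>2 * j + 1\<close> alone
    outweigh all edges at \<open>t j\<close>; the others only add to the sum at \<open>u\<close>.
    This admits group members that also have edges of low rank.\<close>
  have less_S: "?w (t j) < ?w u" if j: "Suc j < k" and u: "u \<in> S (Suc j)" for j u
  proof -
    let ?B = "{e \<in> E. u \<in> e \<and> 2 * j + 1 < r e}"
    have r: "r a = 2 * j + 1" if "a \<in> ?I (t j)" for a
      using rank_pivot[of j a] j that by auto
    have "sum f (?I (t j)) < sum f ?B"
    proof (rule sum_less_of_card_le)
      show "card (?I (t j)) \<le> card ?B"
        using degree_next[OF j u] by (simp add: degree_def)
      have "0 < card (?I (t j))"
        using degree_pivot[of j] j by (simp add: degree_def)
      then obtain a where a: "a \<in> ?I (t j)" by (auto simp: card_gt_0_iff)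
      have "a \<notin> ?B" using r[OF a] by simp
      with a show "?I (t j) \<noteq> ?B" by metis
      fix a b assume "a \<in> ?I (t j) - ?B" "b \<in> ?B - ?I (t j)"
      then show "f a < f b" using r[of a] by (intro rank) auto
    qed (use fin pos in auto)
    also have "\<dots> \<le> ?w u"
      unfolding vertex_sum_def using fin by (intro sum_mono2) auto
    finally show ?thesis by (simp add: vertex_sum_def)
  qed
  have split: "?w u = f {u, t j} + sum f (N {u, t j})" if j: "j < k" and u: "u \<in> S j" for j u
  proof -
    have e: "{u, t j} \<in> E" "r {u, t j} = 2 * j + 1"
      using adjacent[OF j u] rank_pivot[OF j] by auto
    have "x \<in> ?I u \<longleftrightarrow> x = {u, t j} \<or> x \<in> N {u, t j}" for x
    proof (cases "t j \<in> x")
      case True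
      then show ?thesis using e key[OF j u, of x] rank_pivot[OF j, of x] by (auto simp: N_def)
    next
      case False
      then show ?thesis using e rank_group[OF j u, of x] by (auto simp: N_def)
    qed
    then have "?I u = insert {u, t j} (N {u, t j})" by blast
    moreover have "{u, t j} \<notin> N {u, t j}" "finite (N {u, t j})"
      using fin by (auto simp: N_def)
    ultimately show ?thesis by (simp add: vertex_sum_def)
  qed
  have S_inj: "u = u'" if j: "j < k" and u: "u \<in> S j" "u' \<in> S j" and eq: "?w u = ?w u'" for j u u'
  proof -
    have E: "{u, t j} \<in> E" "{u', t j} \<in> E"
      using adjacent j u by auto
    then have r: "r {u, t j} = r {u', t j}"
      using rank_pivot[OF j E(1)] rank_pivot[OF j E(2)] by simp
    \<comment> \<open>A smaller label on the pivot edge comes with a key that is no larger, hence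
      with a strictly smaller sum.\<close>
    have "f {u, t j} = f {u', t j}"
      using sorted[OF E r] sorted[OF E(2,1) r[symmetric]] eq[unfolded split[OF j u(1)] split[OF j u(2)]]
      by linarith
    then have "{u, t j} = {u', t j}"
      using bij E by (auto simp: bij_betw_def dest: inj_onD)
    then show ?thesis using neq[OF j] u by (auto simp: doubleton_eq_iff)
  qed
  have pivots: "?w (t i) < ?w (t j)" if "i < j" "j < k" for i j
    using that
  proof (induction j)
    case (Suc j)
    \<comment> \<open>A member of the next group has its sum strictly between those of two
      consecutive pivots.\<close>
    obtain u where u: "u \<in> S (Suc j)" using S_nonempty[OF Suc.prems(2)] by auto
    have "?w (t j) < ?w (t (Suc j))"
      using less_S[OF Suc.prems(2) u] S_less[OF Suc.prems(2) u] by simp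
    then show ?case using Suc by (cases "i = j") auto
  qed auto
  have less_S': "?w (t i) < ?w u" if "i < j" "j < k" "u \<in> S j" for i j u
  proof (cases j)
    case (Suc j')
    then have "?w (t j') < ?w u" using less_S that by auto
    then show ?thesis using pivots[of i j'] Suc that by (cases "i = j'") auto
  qed (use that in auto)
  have apart: "?w u < ?w v"
    if "i < j" "j < k" "u \<in> insert (t i) (S i)" "v \<in> insert (t j) (S j)" for i j u v
  proof -
    have "?w u \<le> ?w (t i)" using S_less[of i u] that by auto
    also have "\<dots> < ?w v" using pivots less_S' that by auto
    finally show ?thesis .
  qed
  have "inj_on ?w V"
  proof (rule inj_onI)
    fix u v assume uv: "u \<in> V" "v \<in> V" and eq: "?w u = ?w v"
    from uv obtain i j where ij: "i < k" "j < k" "u \<in> insert (t i) (S i)" "v \<in> insert (t j) (S j)"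
      unfolding V by blast
    have "i = j"
      using apart[of i j u v] apart[of j i v u] ij eq by (cases i j rule: linorder_cases) auto
    then show "u = v"
      using ij eq S_inj[of j u v] S_less[of j] by fastforce
  qed
  with bij show ?thesis unfolding antimagic_def by blast
qed

subsection \<open>Edges and degrees of the corona\<close>

lemma corona_E_baseI: "e \<in> EG \<Longrightarrow> Inl ` e \<in> corona_E EG ed m VH EH"
  by (simp add: corona_E_def)

lemma corona_E_copyI:
  "i \<in> {1..m} \<Longrightarrow> e \<in> EH i \<Longrightarrow> (\<lambda>a. Inr (i, a)) ` e \<in> corona_E EG ed m VH EH"
  unfolding corona_E_def by (intro UnI1[OF UnI2] UN_I[of i] imageI)

lemma corona_E_joinI:
  "i \<in> {1..m} \<Longrightarrow> u \<in> ed i \<Longrightarrow> a \<in> VH i \<Longrightarrow> {Inl u, Inr (i, a)} \<in> corona_E EG ed m VH EH"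
  unfolding corona_E_def by (intro UnI2 CollectI exI[of _ u] exI[of _ i] exI[of _ a] conjI refl)

lemma corona_E_cases:
  assumes "e \<in> corona_E EG ed m VH EH"
  obtains (base) e' where "e' \<in> EG" "e = Inl ` e'"
    | (copy) i e' where "i \<in> {1..m}" "e' \<in> EH i" "e = (\<lambda>a. Inr (i, a)) ` e'"
    | (join) i u a where "i \<in> {1..m}" "u \<in> ed i" "a \<in> VH i" "e = {Inl u, Inr (i, a)}"
  using assms unfolding corona_E_def by (elim UnE imageE UN_E CollectE exE conjE) (rule that; assumption)+

lemma corona_V_eq: "corona_V VG m VH = Inl ` VG \<union> Inr ` Sigma {1..m} VH"
  by (auto simp: corona_V_def)

lemma simple_graph_corona:
  assumes G: "simple_graph VG EG"
    and H: "\<And>i. i \<in> {1..m} \<Longrightarrow> simple_graph (VH i) (EH i)"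
    and ed: "\<And>i. i \<in> {1..m} \<Longrightarrow> ed i \<subseteq> VG"
  shows "simple_graph (corona_V VG m VH) (corona_E EG ed m VH EH)"
  unfolding simple_graph_def
proof (intro conjI ballI)
  show "finite (corona_V VG m VH)"
    using G H finite_SigmaI[of "{1..m}" VH] by (simp add: corona_V_eq simple_graph_def)
  fix e assume "e \<in> corona_E EG ed m VH EH"
  then show "\<exists>u v. e = {u, v} \<and> u \<in> corona_V VG m VH \<and> v \<in> corona_V VG m VH \<and> u \<noteq> v"
  proof (cases rule: corona_E_cases)
    case (base e')
    obtain u v where "e' = {u, v}" "u \<in> VG" "v \<in> VG" "u \<noteq> v"
      using simple_graph_edgeE[OF G base(1)] .
    with base have "e = {Inl u, Inl v}" "Inl u \<in> corona_V VG m VH" "Inl v \<in> corona_V VG m VH" "Inl u \<noteq> Inl v"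
      by (auto simp: corona_V_def)
    then show ?thesis by metis
  next
    case (copy i e')
    obtain u v where "e' = {u, v}" "u \<in> VH i" "v \<in> VH i" "u \<noteq> v"
      using simple_graph_edgeE[OF H[OF copy(1)] copy(2)] .
    with copy have "e = {Inr (i, u), Inr (i, v)}" "Inr (i, u) \<in> corona_V VG m VH" "Inr (i, v) \<in> corona_V VG m VH" "Inr (i, u) \<noteq> Inr (i, v)"
      by (auto simp: corona_V_def)
    then show ?thesis by metis
  next
    case (join i u a)
    have "e = {Inl u, Inr (i, a)}" "Inl u \<in> corona_V VG m VH" "Inr (i, a) \<in> corona_V VG m VH" "Inl u \<noteq> Inr (i, a)"
      using join ed[OF join(1)] by (auto simp: corona_V_def)
    then show ?thesis by metis
  qed
qed

text \<open>The join edges at \<open>v\<close> correspond to pairs of a copy whose base edge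
  contains \<open>v\<close> and a vertex of that copy; a sigma set counts them.\<close>

lemma degree_corona_Inl:
  fixes VH :: "nat \<Rightarrow> 'a set" and v :: 'v
  assumes G: "finite EG" and H: "\<And>i. i \<in> {1..m} \<Longrightarrow> finite (VH i)"
  shows "degree (corona_E EG ed m VH EH) (Inl v)
    = degree EG v + (\<Sum>i | i \<in> {1..m} \<and> v \<in> ed i. card (VH i))"
proof -
  let ?inl = "Inl :: 'v \<Rightarrow> 'v + nat \<times> 'a"
  let ?A = "(`) ?inl ` {e \<in> EG. v \<in> e}"
  let ?J = "{i. i \<in> {1..m} \<and> v \<in> ed i}"
  let ?B = "(\<lambda>x. {Inl v, Inr x}) ` (SIGMA i:?J. VH i)"
  have "{e \<in> corona_E EG ed m VH EH. Inl v \<in> e} = ?A \<union> ?B"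
    unfolding corona_E_def by blast
  moreover have "finite (SIGMA i:?J. VH i)" using H by (intro finite_SigmaI) auto
  then have "card (?A \<union> ?B) = card ?A + card ?B"
    using G by (intro card_Un_disjoint) auto
  moreover have "card ?A = degree EG v"
    unfolding degree_def by (intro card_image inj_onI) (simp add: inj_image_eq_iff)
  moreover have "card ?B = (\<Sum>i\<in>?J. card (VH i))"
    using H by (subst card_image) (auto simp: inj_on_def doubleton_eq_iff intro!: card_SigmaI)
  ultimately show ?thesis by (simp add: degree_def)
qed

lemma degree_corona_Inr:
  fixes ed :: "nat \<Rightarrow> 'v set" and a :: 'a
  assumes i: "i \<in> {1..m}" and a: "a \<in> VH i" and fin: "finite (EH i)" "finite (ed i)"
  shows "degree (corona_E EG ed m VH EH) (Inr (i, a)) = degree (EH i) a + card (ed i)"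
proof -
  let ?h = "\<lambda>a. Inr (i, a) :: 'v + nat \<times> 'a"
  let ?A = "(`) ?h ` {e \<in> EH i. a \<in> e}"
  let ?B = "(\<lambda>u. {Inl u, Inr (i, a)}) ` ed i"
  have "{e \<in> corona_E EG ed m VH EH. Inr (i, a) \<in> e} = ?A \<union> ?B" (is "?I = _")
  proof
    show "?I \<subseteq> ?A \<union> ?B"
    proof
      fix e assume "e \<in> ?I"
      then have "e \<in> corona_E EG ed m VH EH" "Inr (i, a) \<in> e" by auto
      then show "e \<in> ?A \<union> ?B"
      proof (cases rule: corona_E_cases)
        case (copy i' e')
        with \<open>Inr (i, a) \<in> e\<close> have "i' = i" "a \<in> e'" by auto
        with copy show ?thesis by blast
      qed auto
    qed
    show "?A \<union> ?B \<subseteq> ?I"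
    proof
      fix e assume "e \<in> ?A \<union> ?B"
      then consider e' where "e' \<in> EH i" "a \<in> e'" "e = ?h ` e'"
        | u where "u \<in> ed i" "e = {Inl u, Inr (i, a)}"
        by blast
      then show "e \<in> ?I"
        using corona_E_copyI[OF i] corona_E_joinI[OF i, of _ ed a VH, OF _ a] by cases auto
    qed
  qed
  \<comment> \<open>Join edges contain a base vertex, edges inside a copy do not.\<close>
  moreover have "?A \<inter> ?B = {}"
  proof -
    have "Inl u \<notin> e" if "e \<in> ?A" for e u using that by auto
    moreover have "\<exists>u. Inl u \<in> e" if "e \<in> ?B" for e using that by auto
    ultimately show ?thesis by blast
  qed
  then have "card (?A \<union> ?B) = card ?A + card ?B"
    using fin by (intro card_Un_disjoint) simp_all
  moreover have "inj ?h" by (simp add: inj_def)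
  then have "card ?A = degree (EH i) a"
    unfolding degree_def by (intro card_image inj_onI) (auto simp: inj_image_eq_iff)
  moreover have "card ?B = card (ed i)"
    by (intro card_image) (auto simp: inj_on_def doubleton_eq_iff)
  ultimately show ?thesis by (simp add: degree_def)
qed

subsection \<open>Spiders\<close>

text \<open>Evaluates explicit finite sets one element at a time in the degree counts below.\<close>

lemma Collect_insert_filter:
  "{x \<in> insert a A. P x} = (if P a then insert a {x \<in> A. P x} else {x \<in> A. P x})"
  by auto

lemma spider_E_Suc: "spider_E (Suc p) = spider_E p \<union> (\<lambda>l. {spider_pt l p, spider_pt l (Suc p)}) ` {0, 1, 2}"
proof -
  have "l < 3 \<longleftrightarrow> l \<in> {0, 1, 2}" for l :: nat by auto
  then show ?thesis unfolding spider_E_def by (auto simp: less_Suc_eq)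
qed

lemma spider_E_0: "spider_E 0 = {}"
  by (simp add: spider_E_def)

lemma spider_E_1: "spider_E 1 = {{(0,0), (0,1)}, {(0,0), (1,1)}, {(0,0), (2,1)}}"
  unfolding One_nat_def spider_E_Suc spider_E_0 by (simp add: spider_pt_def)

lemma spider_E_2: "spider_E 2 = {{(0,0), (0,1)}, {(0,0), (1,1)}, {(0,0), (2,1)},
    {(0,1), (0,2)}, {(1,1), (1,2)}, {(2,1), (2,2)}}"
  unfolding numeral_2_eq_2 spider_E_Suc spider_E_0 by (auto simp: spider_pt_def numeral_2_eq_2)

lemma simple_graph_spider: "simple_graph (spider_V p) (spider_E p)"
proof -
  have "spider_V p \<subseteq> {..<3} \<times> {..p}" by (auto simp: spider_V_def)
  then have "finite (spider_V p)" by (rule finite_subset) auto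
  then show ?thesis
    unfolding simple_graph_def spider_E_def
    by (fastforce simp: spider_pt_def spider_V_def)
qed

lemma spider_ed_subset: "spider_ed p i \<subseteq> spider_V p"
  by (auto simp: spider_ed_def spider_pt_def spider_V_def Let_def)

lemma less_3_cases: "(l::nat) < 3 \<longleftrightarrow> l = 0 \<or> l = 1 \<or> l = 2"
  by auto

lemma spider_ed_1:
  "l < 3 \<Longrightarrow> spider_ed 1 (l + 1) = {(l, 1), (0, 0)}"
  unfolding less_3_cases by (elim disjE) (simp_all add: spider_ed_def spider_pt_def)

text \<open>Copies are numbered from the leg ends inwards: 1, 2, 3 sit on the outer edges and 4, 5,
  6 on the edges at the centre.\<close>

lemma spider_ed_2:
  "l < 3 \<Longrightarrow> spider_ed 2 (l + 1) = {(l, 2), (l, 1)}"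
  "l < 3 \<Longrightarrow> spider_ed 2 (l + 4) = {(l, 1), (0, 0)}"
  unfolding less_3_cases by (elim disjE; simp add: spider_ed_def spider_pt_def)+

section \<open>Degrees and edge types in the corona of a spider\<close>

lemma degree_Gamma_1:
  assumes "\<forall>i\<in>{1..3}. finite (VH i)"
  shows "degree (Gamma_E 1 VH EH) (Inl (0, 0)) = 3 + card (VH 1) + card (VH 2) + card (VH 3)"
    "l < 3 \<Longrightarrow> degree (Gamma_E 1 VH EH) (Inl (l, 1)) = 1 + card (VH (l + 1))"
proof -
  have I: "{1..3 * 1} = {1, 2, 3::nat}" by auto
  have d: "degree (Gamma_E 1 VH EH) (Inl v) = degree (spider_E 1) v
      + (\<Sum>i | i \<in> {1..3 * 1} \<and> v \<in> spider_ed 1 i. card (VH i))" for v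
    by (intro degree_corona_Inl finite_edges[OF simple_graph_spider]) (use assms in auto)
  show "degree (Gamma_E 1 VH EH) (Inl (0, 0)) = 3 + card (VH 1) + card (VH 2) + card (VH 3)"
    unfolding d unfolding degree_def spider_E_1 I Collect_insert_filter
    by (simp add: spider_ed_def spider_pt_def doubleton_eq_iff)
  show "degree (Gamma_E 1 VH EH) (Inl (l, 1)) = 1 + card (VH (l + 1))" if "l < 3"
    using that unfolding less_3_cases d unfolding degree_def spider_E_1 I Collect_insert_filter
    by (elim disjE; simp add: spider_ed_def spider_pt_def doubleton_eq_iff numeral_2_eq_2[symmetric])
qed

lemma degree_Gamma_2:
  assumes "\<forall>i\<in>{1..6}. finite (VH i)"
  shows "degree (Gamma_E 2 VH EH) (Inl (0, 0)) = 3 + card (VH 4) + card (VH 5) + card (VH 6)"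
    "l < 3 \<Longrightarrow> degree (Gamma_E 2 VH EH) (Inl (l, 1)) = 2 + card (VH (l + 1)) + card (VH (l + 4))"
    "l < 3 \<Longrightarrow> degree (Gamma_E 2 VH EH) (Inl (l, 2)) = 1 + card (VH (l + 1))"
proof -
  have I: "{1..3 * 2} = {1, 2, 3, 4, 5, 6::nat}" by auto
  have d: "degree (Gamma_E 2 VH EH) (Inl v) = degree (spider_E 2) v
      + (\<Sum>i | i \<in> {1..3 * 2} \<and> v \<in> spider_ed 2 i. card (VH i))" for v
    by (intro degree_corona_Inl finite_edges[OF simple_graph_spider]) (use assms in auto)
  show "degree (Gamma_E 2 VH EH) (Inl (0, 0)) = 3 + card (VH 4) + card (VH 5) + card (VH 6)"
    unfolding d unfolding degree_def spider_E_2 I Collect_insert_filter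
    by (simp add: spider_ed_def spider_pt_def doubleton_eq_iff)
  show "degree (Gamma_E 2 VH EH) (Inl (l, 1)) = 2 + card (VH (l + 1)) + card (VH (l + 4))" if "l < 3"
    using that unfolding less_3_cases d unfolding degree_def spider_E_2 I Collect_insert_filter
    by (elim disjE; simp add: spider_ed_def spider_pt_def doubleton_eq_iff numeral_2_eq_2[symmetric])
  show "degree (Gamma_E 2 VH EH) (Inl (l, 2)) = 1 + card (VH (l + 1))" if "l < 3"
    using that unfolding less_3_cases d unfolding degree_def spider_E_2 I Collect_insert_filter
    by (elim disjE; simp add: spider_ed_def spider_pt_def doubleton_eq_iff numeral_2_eq_2[symmetric])
qed

lemma Gamma_2_edge_cases:
  assumes "e \<in> Gamma_E 2 VH EH"
  obtains (foot) l where "l < 3" "e = {Inl (0, 0), Inl (l, 1)}"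
    | (leg) l where "l < 3" "e = {Inl (l, 1), Inl (l, 2)}"
    | (copy) i e' where "i \<in> {1..6}" "e' \<in> EH i" "e = (\<lambda>a. Inr (i, a)) ` e'"
    | (outer) l j a where "l < 3" "j \<in> {1, 2}" "a \<in> VH (l + 1)" "e = {Inl (l, j), Inr (l + 1, a)}"
    | (inner) l u a where "l < 3" "u \<in> {(0, 0), (l, 1)}" "a \<in> VH (l + 4)" "e = {Inl u, Inr (l + 4, a)}"
  using assms
proof (cases rule: corona_E_cases)
  case (base e')
  then have "(\<exists>l<3. e = {Inl (0, 0), Inl (l, 1)}) \<or> (\<exists>l<3. e = {Inl (l, 1), Inl (l, 2)})"
    unfolding spider_E_2 less_3_cases by auto
  then show thesis using foot leg by metis
next
  case (copy i e')
  then show thesis using that(3) by simp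
next
  case (join i u a)
  consider l where "l < 3" "i = l + 1" | l where "l < 3" "i = l + 4"
  proof (cases "i \<le> 3")
    case True
    then show thesis using that(1)[of "i - 1"] join(1) by simp
  next
    case False
    then show thesis using that(2)[of "i - 4"] join(1) by simp
  qed
  then show thesis
  proof cases
    case 1
    have "\<exists>j\<in>{1, 2}. u = (l, j)" using join(2) unfolding 1(2) spider_ed_2(1)[OF 1(1)] by auto
    then show thesis using outer 1 join by blast
  next
    case 2
    have "u \<in> {(0, 0), (l, 1)}" using join(2) unfolding 2(2) spider_ed_2(2)[OF 2(1)] by auto
    then show thesis using inner 2 join by blast
  qed
qed

section \<open>Legs of length one\<close>

lemma antimagic_Gamma_1:
  fixes VH :: "nat \<Rightarrow> 'a set"
  assumes H: "\<And>i. i \<in> {1..3} \<Longrightarrow> simple_graph (VH i) (EH i)"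
  shows "antimagic (Gamma_V 1 VH) (Gamma_E 1 VH EH)"
proof -
  let ?E = "Gamma_E 1 VH EH"
  let ?v = "Inl (0, 0) :: nat \<times> nat + nat \<times> 'a"
  let ?S = "Inl ` ((\<lambda>l. (l, 1::nat)) ` {..<3::nat}) \<union> Inr ` (SIGMA i:{1..3}. VH i)"
  have fin: "finite (VH i)" if "i \<in> {1..3}" for i
    using H[OF that] by (simp add: simple_graph_def)
  then have finV: "\<forall>i\<in>{1..3}. finite (VH i)" by blast
  have join: "{Inl u, Inr (i, a)} \<in> ?E" if "i \<in> {1..3}" "u \<in> spider_ed 1 i" "a \<in> VH i" for u i a
    using that by (intro corona_E_joinI) auto
  have ed: "spider_ed 1 i = {(i - 1, 1), (0, 0)}" if "i \<in> {1..3}" for i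
    using spider_ed_1[of "i - 1"] that by auto
  have leq: "card (VH i) \<le> card (VH 1) + card (VH 2) + card (VH 3)" if "i \<in> {1..3}" for i
  proof -
    have "i = 1 \<or> i = 2 \<or> i = 3" using that by auto
    then show ?thesis by auto
  qed
  show ?thesis
  \<comment> \<open>The centre is adjacent to every other vertex, so one pivot suffices: rank 1 for
    its edges, rank 0 for the rest. The condition comparing a pivot with the next group is vacuous
    for \<open>k = 1\<close>.\<close>
  proof (rule antimagic_of_pivots[where k = 1 and t = "\<lambda>_. ?v" and S = "\<lambda>_. ?S"
        and r = "\<lambda>e. if ?v \<in> e then 1 else 0"])
    show "simple_graph (Gamma_V 1 VH) ?E"
      using H by (intro simple_graph_corona simple_graph_spider spider_ed_subset) auto
    show "Gamma_V 1 VH = (\<Union>j<(1::nat). insert ?v ?S)"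
      by (auto simp: corona_V_def spider_V_def image_iff)
    fix j :: nat and u
    assume u: "u \<in> ?S"
    then consider (tip) l where "l < 3" "u = Inl (l, 1)"
      | (copy) i a where "i \<in> {1..3}" "a \<in> VH i" "u = Inr (i, a)" by auto
    note u_cases = this
    show "{u, ?v} \<in> ?E"
    proof (cases rule: u_cases)
      case tip
      have "{(0, 0), (l, 1)} \<in> spider_E 1"
        using tip unfolding less_3_cases spider_E_1 by auto
      from corona_E_baseI[OF this] show ?thesis using tip by (simp add: insert_commute)
    next
      case copy
      then show ?thesis using join[of i "(0, 0)" a] ed by (simp add: insert_commute)
    qed
    show "degree ?E u \<le> degree ?E ?v"
    proof (cases rule: u_cases)
      case tip
      then show ?thesis
        using degree_Gamma_1[OF finV] leq[of "l + 1"] by simp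
    next
      case copy
      have "degree ?E u = degree (EH i) a + card (spider_ed 1 i)"
        unfolding copy(3) using copy ed finite_edges[OF H] by (intro degree_corona_Inr) auto
      also have "\<dots> \<le> degree (EH i) a + 2" using ed[OF copy(1)] by (simp add: card_insert_if)
      also have "\<dots> \<le> card (VH i) + 1"
        using degree_less_card[OF H[OF copy(1)] copy(2)] by simp
      also have "\<dots> \<le> degree ?E ?v"
        using degree_Gamma_1(1)[OF finV] leq[OF copy(1)] by simp
      finally show ?thesis .
    qed
  qed (use degree_Gamma_1(1)[OF finV] in \<open>auto simp: lessThan_empty_iff\<close>)
qed

section \<open>Legs of length two\<close>

lemma spider_ed_2_eq:
  assumes "i \<in> {1..6}"
  shows "spider_ed 2 i = (if i \<le> 3 then {(i - 1, 2), (i - 1, 1)} else {(i - 4, 1), (0, 0)})"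
  using spider_ed_2(1)[of "i - 1"] spider_ed_2(2)[of "i - 4"] assms by (auto simp: not_le)

lemma degree_Gamma_2_copy:
  assumes "i \<in> {1..6}" "a \<in> VH i" "finite (EH i)"
  shows "degree (Gamma_E 2 VH EH) (Inr (i, a)) = degree (EH i) a + 2"
  using assms spider_ed_2_eq[OF assms(1)] by (subst degree_corona_Inr) auto

text \<open>\<open>tip\<close> and \<open>last\<close> are degree comparisons after cancellation:
  the pivot \<open>Inl (l, 2)\<close> has degree \<open>card (VH (l + 1)) + 1\<close>, and a vertex
  of a copy gains two join edges. \<open>tip\<close> compares each leg end with the next copy;
  \<open>last\<close> compares the third leg end with all copies in the last group.\<close>

lemma antimagic_Gamma_2:
  fixes VH :: "nat \<Rightarrow> 'a set"
  assumes H: "\<And>i. i \<in> {1..6} \<Longrightarrow> simple_graph (VH i) (EH i)"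
    and nonempty: "\<And>i. i \<in> {1..6} \<Longrightarrow> VH i \<noteq> {}"
    and order: "\<And>i j. i \<in> {1..6} \<Longrightarrow> j \<in> {1..6} \<Longrightarrow> i \<le> j \<Longrightarrow> card (VH i) \<le> card (VH j)"
    and tip: "\<And>l a. l < 3 \<Longrightarrow> a \<in> VH (l + 2) \<Longrightarrow> card (VH (l + 1)) \<le> degree (EH (l + 2)) a + 1"
    and last: "\<And>i a. i \<in> {4..6} \<Longrightarrow> a \<in> VH i \<Longrightarrow> card (VH 3) \<le> degree (EH i) a + 1"
  shows "antimagic (Gamma_V 2 VH) (Gamma_E 2 VH EH)"
proof -
  let ?E = "Gamma_E 2 VH EH"
  define t :: "nat \<Rightarrow> nat \<times> nat + nat \<times> 'a" where "t = (\<lambda>j. if j < 3 then Inl (j, 2) else Inl (0, 0))"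
  define S :: "nat \<Rightarrow> (nat \<times> nat + nat \<times> 'a) set"
    where "S = (\<lambda>j. if j < 3 then Inr ` ({j + 1} \<times> VH (j + 1))
      else Inl ` ((\<lambda>l. (l, 1)) ` {..<3::nat}) \<union> Inr ` (SIGMA i:{4..6}. VH i))"
  \<comment> \<open>The \<open>SOME\<close> is only evaluated where it is meaningful: every edge of \<open>\<Gamma>\<close> avoiding all pivots
    meets exactly one of the copies.\<close>
  define pivots where "pivots = (\<lambda>e j. j < 4 \<and> t j \<in> e)"
  define r where "r = (\<lambda>e. if Ex (pivots e) then 2 * Eps (pivots e) + 1
      else 2 * min ((SOME i. \<exists>a. Inr (i, a) \<in> e) - 1) 3)"
  have fin: "finite (VH i)" if "i \<in> {1..6}" for i
    using H[OF that] by (simp add: simple_graph_def)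
  then have finV: "\<forall>i\<in>{1..6}. finite (VH i)" by blast
  note ed = spider_ed_2_eq
  have join: "{Inl u, Inr (i, a)} \<in> ?E" if "i \<in> {1..6}" "u \<in> spider_ed 2 i" "a \<in> VH i" for u i a
    using that by (intro corona_E_joinI) auto
  have foot: "{Inl (0, 0), Inl (l, 1)} \<in> ?E" if "l < 3" for l
  proof -
    have "{(0, 0), (l, 1)} \<in> spider_E 2"
      using that unfolding less_3_cases spider_E_2 by auto
    from corona_E_baseI[OF this] show ?thesis by simp
  qed
  have deg_copy: "degree ?E (Inr (i, a)) = degree (EH i) a + 2" if "i \<in> {1..6}" "a \<in> VH i" for i a
    using that by (intro degree_Gamma_2_copy finite_edges[OF H])
  have simple: "simple_graph (Gamma_V 2 VH) ?E"
    using H by (intro simple_graph_corona simple_graph_spider spider_ed_subset) auto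
  \<comment> \<open>At most \<open>card (VH i) - 1\<close> edges inside the copy and two join edges.
    For \<open>i\<close> up to 3 this bound is exactly the degree of the leg end to which the copy
    is joined.\<close>
  have deg_copy_le: "degree ?E (Inr (i, a)) \<le> card (VH i) + 1" if "i \<in> {1..6}" "a \<in> VH i" for i a
    using degree_less_card[OF H[OF that(1)] that(2)] deg_copy[OF that] by simp
  note deg = degree_Gamma_2[OF finV, where EH = EH]
  \<comment> \<open>The pivots are pairwise nonadjacent, so an edge contains at most one of
    them.\<close>
  have pivots_unique: "i = j" if "e \<in> ?E" "pivots e i" "pivots e j" for e i j
    using that(1)
  proof (cases rule: Gamma_2_edge_cases)
    case (inner l u a)
    then show ?thesis using that(2,3) by (auto simp: pivots_def t_def split: if_splits)
  qed (use that(2,3) in \<open>auto simp: pivots_def t_def split: if_splits\<close>)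
  have copy_unique: "i = i'" if "e \<in> ?E" "Inr (i, a) \<in> e" "Inr (i', a') \<in> e" for e i i' a a'
    using that(1) by (cases rule: Gamma_2_edge_cases) (use that(2,3) in auto)
  \<comment> \<open>\<open>min (i - 1) 3\<close> is the index of the group containing copy
    \<open>i\<close>: copies 1, 2, 3 form groups 0, 1, 2, and copies 4, 5, 6 all lie in group
    3.\<close>
  have pivot_copy: "j = min (i - 1) 3" if "e \<in> ?E" "pivots e j" "Inr (i, a) \<in> e" for e i j a
    using that(1)
    by (cases rule: Gamma_2_edge_cases) (use that(2,3) in \<open>auto simp: pivots_def t_def split: if_splits\<close>)
  have r_pivot: "r e = 2 * j + 1" if "e \<in> ?E" "pivots e j" for e j
  proof -
    have "Eps (pivots e) = j"
      by (rule some_equality) (use that(2) pivots_unique[OF that(1) _ that(2)] in blast)+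
    then show ?thesis using that(2) by (auto simp: r_def)
  qed
  have r_no_pivot: "r e = 2 * min ((SOME i. \<exists>a. Inr (i, a) \<in> e) - 1) 3" if "\<not> Ex (pivots e)" for e
    using that by (simp only: r_def if_False)
  have rank_pivot: "t j \<in> e \<longleftrightarrow> r e = 2 * j + 1" if "j < 4" "e \<in> ?E" for j e
  proof
    assume "t j \<in> e"
    then show "r e = 2 * j + 1" using r_pivot that by (simp add: pivots_def)
  next
    assume r: "r e = 2 * j + 1"
    \<comment> \<open>Parity: an edge without a pivot has even rank.\<close>
    have "Ex (pivots e)"
    proof (rule ccontr)
      assume "\<not> Ex (pivots e)"
      from r_no_pivot[OF this] have "even (r e)" by simp
      then show False using r by simp
    qed
    then obtain j' where "pivots e j'" by blast
    with r_pivot[OF that(2) this] r show "t j \<in> e" by (simp add: pivots_def)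
  qed
  have rank_copy: "2 * min (i - 1) 3 \<le> r e \<and> r e \<le> 2 * min (i - 1) 3 + 1"
    if e: "e \<in> ?E" "Inr (i, a) \<in> e" for i a e
  proof (cases "Ex (pivots e)")
    case True
    then obtain j where j: "pivots e j" by blast
    show ?thesis using r_pivot[OF e(1) j] pivot_copy[OF e(1) j e(2)] by simp
  next
    case False
    have "(SOME i. \<exists>a. Inr (i, a) \<in> e) = i"
      by (rule some_equality) (use e(2) copy_unique[OF e(1) _ e(2)] in blast)+
    with r_no_pivot[OF False] show ?thesis by simp
  qed
  have rank_le: "r e \<le> 7" if "e \<in> ?E" for e
  proof (cases "Ex (pivots e)")
    case True
    then obtain j where "pivots e j" by blast
    with r_pivot[OF that this] show ?thesis by (simp add: pivots_def)
  qed (simp add: r_no_pivot)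
  have pivot_cases: "(j < 3 \<and> t j = Inl (j, 2)) \<or> (j = 3 \<and> t j = Inl (0, 0))" if "j < 4" for j
    using that by (auto simp: t_def)
  have in_S: "(j < 3 \<and> (\<exists>a\<in>VH (j + 1). u = Inr (j + 1, a)))
      \<or> (j = 3 \<and> ((\<exists>l<3. u = Inl (l, 1)) \<or> (\<exists>i\<in>{4..6}. \<exists>a\<in>VH i. u = Inr (i, a))))"
    if "j < 4" "u \<in> S j" for j u
    using that by (auto simp: S_def split: if_splits)
  show ?thesis
  proof (rule antimagic_of_pivots[where k = 4 and t = t and S = S and r = r])
    show "simple_graph (Gamma_V 2 VH) ?E" by (fact simple)
    define A where "A = (\<lambda>i. Inr ` ({i} \<times> VH i) :: (nat \<times> nat + nat \<times> 'a) set)"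
    define B where "B = (Inr ` (SIGMA i:{4..6}. VH i) :: (nat \<times> nat + nat \<times> 'a) set)"
    have S: "S 0 = A 1" "S 1 = A 2" "S 2 = A 3" "S 3 = {Inl (0, 1), Inl (1, 1), Inl (2, 1)} \<union> B"
      by (simp_all add: S_def A_def B_def numeral_2_eq_2 numeral_3_eq_3 lessThan_Suc insert_commute)
    have t: "t 0 = Inl (0, 2)" "t 1 = Inl (1, 2)" "t 2 = Inl (2, 2)" "t 3 = Inl (0, 0)"
      by (simp_all add: t_def)
    have V: "Gamma_V 2 VH = Inl ` spider_V 2 \<union> (A 1 \<union> A 2 \<union> A 3 \<union> B)"
    proof -
      have "{1..3 * 2} = {1} \<union> {2} \<union> {3} \<union> {4..6::nat}" by auto
      then have "Sigma {1..3 * 2} VH = Sigma {1} VH \<union> Sigma {2} VH \<union> Sigma {3} VH \<union> Sigma {4..6} VH"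
        by (simp only: Sigma_Un_distrib1)
      moreover have "Sigma {i} VH = {i} \<times> VH i" for i by auto
      ultimately show ?thesis unfolding corona_V_eq A_def B_def by (simp only: image_Un)
    qed
    have spider_V: "spider_V 2 = {(0, 0), (0, 1), (1, 1), (2, 1), (0, 2), (1, 2), (2, 2)}"
    proof -
      have "l < 3 \<and> 1 \<le> j \<and> j \<le> 2 \<longleftrightarrow> (l = 0 \<or> l = 1 \<or> l = 2) \<and> (j = 1 \<or> j = 2)" for l j :: nat
        by auto
      then show ?thesis unfolding spider_V_def by auto
    qed
    have I: "{..<4} = {0, 1, 2, 3::nat}" by auto
    show "Gamma_V 2 VH = (\<Union>j<4. insert (t j) (S j))"
      unfolding V unfolding spider_V I UN_insert UN_empty S t
      by (simp only: image_insert image_empty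
        Un_insert_left Un_insert_right Un_empty_left Un_empty_right insert_commute Un_ac)
    show "S j \<noteq> {}" if "j < 4" for j
      using nonempty[of "j + 1"] by (auto simp: S_def lessThan_empty_iff)
    show "t j \<in> e \<longleftrightarrow> r e = 2 * j + 1" if "j < 4" "e \<in> ?E" for j e
      using rank_pivot that .
    show "1 < degree ?E (t j)" if "j < 4" for j
    proof -
      have "0 < card (VH (j + 1))"
        using that nonempty[of "j + 1"] fin[of "j + 1"] by (simp add: card_gt_0_iff)
      then show ?thesis using pivot_cases[OF that] deg by auto
    qed
    show "{u, t j} \<in> ?E" if "j < 4" "u \<in> S j" for j u
      using in_S[OF that]
    proof (elim disjE conjE bexE exE)
      fix a assume "j < 3" "a \<in> VH (j + 1)" "u = Inr (j + 1, a)"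
      then show ?thesis using join[of "j + 1" "(j, 2)" a] ed[of "j + 1"] by (simp add: insert_commute t_def)
    next
      fix l assume "j = 3" "l < 3" "u = Inl (l, 1)"
      then show ?thesis using foot[of l] by (simp add: insert_commute t_def)
    next
      fix i a assume "j = 3" "i \<in> {4..6}" "a \<in> VH i" "u = Inr (i, a)"
      then show ?thesis using join[of i "(0, 0)" a] ed[of i] by (simp add: insert_commute t_def)
    qed
    show "r e \<le> 2 * j" if prems: "j < 4" "u \<in> S j" "e \<in> ?E" "u \<in> e" "t j \<notin> e" for j u e
    proof (cases "j = 3")
      case True
      then show ?thesis using rank_le[OF prems(3)] rank_pivot[OF prems(1,3)] prems(5) by simp
    next
      case False
      then obtain a where "u = Inr (j + 1, a)" "j < 3" using in_S[OF prems(1,2)] by auto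
      then have "r e \<le> 2 * j + 1" using rank_copy[OF prems(3), of "j + 1" a] prems(4) by simp
      then show ?thesis using rank_pivot[OF prems(1,3)] prems(5) by simp
    qed
    show "degree ?E u \<le> degree ?E (t j)" if "j < 4" "u \<in> S j" for j u
      using in_S[OF that]
    proof (elim disjE conjE bexE exE)
      fix a assume "j < 3" "a \<in> VH (j + 1)" "u = Inr (j + 1, a)"
      then show ?thesis using deg_copy_le[of "j + 1" a] deg(3)[of j] by (simp add: t_def)
    next
      fix l assume l: "j = 3" "l < 3" "u = Inl (l, 1)"
      \<comment> \<open>Copy \<open>l + 4\<close> occurs on both sides; copy \<open>l + 1\<close> is
        absorbed by another inner copy, namely 5 for \<open>l = 0\<close> and 4 for
        \<open>l = 1\<close> and \<open>l = 2\<close>.\<close>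
      have "l = 0 \<or> l = 1 \<or> l = 2" using l by auto
      then have "card (VH (l + 1)) + card (VH (l + 4)) \<le> card (VH 4) + card (VH 5) + card (VH 6)"
        using order[of 1 5] order[of 2 4] order[of 3 4] by (auto simp: numeral_2_eq_2[symmetric])
      then show ?thesis using l deg(1) deg(2)[of l] by (simp add: t_def)
    next
      fix i a assume i: "j = 3" "i \<in> {4..6}" "a \<in> VH i" "u = Inr (i, a)"
      then have "card (VH i) \<le> card (VH 6)" by (intro order) auto
      then show ?thesis using i deg(1) deg_copy_le[of i a] by (simp add: t_def)
    qed
    show "degree ?E (t j) \<le> card {e \<in> ?E. u \<in> e \<and> 2 * j + 1 < r e}"
      if "Suc j < 4" "u \<in> S (Suc j)" for j u
    proof -
      have deg_t: "degree ?E (t j) = 1 + card (VH (j + 1))"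
        using that deg(3)[of j] by (simp add: t_def)
      have copy: "degree ?E (t j) \<le> card {e \<in> ?E. u \<in> e \<and> 2 * j + 1 < r e}"
        if "i \<in> {1..6}" "a \<in> VH i" "u = Inr (i, a)" "card (VH (j + 1)) \<le> degree (EH i) a + 1"
          "if i \<le> 3 then j + 2 = i else j = 2" for i a
      proof -
        \<comment> \<open>Copy \<open>i\<close> lies in group \<open>j + 1\<close>, so every edge at
          \<open>u\<close> has rank at least \<open>2 * j + 2\<close> and the full degree
          counts.\<close>
        have "{e \<in> ?E. u \<in> e \<and> 2 * j + 1 < r e} = {e \<in> ?E. u \<in> e}"
          using rank_copy[of _ i a] that by (fastforce split: if_splits)
        then show ?thesis using deg_copy[OF that(1,2)] that deg_t by (simp add: degree_def)
      qed
      from in_S[OF that] show ?thesis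
      proof (elim disjE conjE bexE exE)
        fix a assume "Suc j < 3" "a \<in> VH (Suc j + 1)" "u = Inr (Suc j + 1, a)"
        then show ?thesis using tip[of j a] by (intro copy[of "j + 2" a]) auto
      next
        fix i a assume "Suc j = 3" "i \<in> {4..6}" "a \<in> VH i" "u = Inr (i, a)"
        then show ?thesis using last[of i a] by (intro copy[of i a]) auto
      next
        fix l assume l: "Suc j = 3" "l < 3" "u = Inl (l, 1)"
        \<comment> \<open>Here \<open>j = 2\<close>, so ranks above 5 count. The edges from
          \<open>Inl (l, 1)\<close> to copy \<open>l + 4\<close> have rank at least 6 and the edge
          to the centre has rank 7. These \<open>card (VH (l + 4)) + 1\<close> edges already match
          the degree \<open>card (VH 3) + 1\<close> of the third leg end.\<close>
        let ?A = "(\<lambda>a. {Inl (l, 1), Inr (l + 4, a)} :: (nat \<times> nat + nat \<times> 'a) set) ` VH (l + 4)"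
        let ?B = "insert {Inl (0, 0), Inl (l, 1)} ?A"
        have "?B \<subseteq> {e \<in> ?E. u \<in> e \<and> 5 < r e}"
        proof -
          have "5 < r e" if "e \<in> ?A" "e \<in> ?E" for e
            using that rank_copy[of e "l + 4"] by fastforce
          moreover have "?A \<subseteq> ?E" using join[of "l + 4" "(l, 1)"] ed[of "l + 4"] l by auto
          moreover have "5 < r {Inl (0, 0), Inl (l, 1)}"
            using rank_pivot[of 3, OF _ foot[OF l(2)]] by (simp add: t_def)
          ultimately show ?thesis using foot[OF l(2)] l by auto
        qed
        then have "card ?B \<le> card {e \<in> ?E. u \<in> e \<and> 5 < r e}"
          using finite_edges[OF simple] by (intro card_mono) auto
        moreover have "card ?B = card (VH (l + 4)) + 1"
          using fin[of "l + 4"] l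
          by (subst card_insert_disjoint) (auto simp: card_image inj_on_def doubleton_eq_iff)
        moreover have "card (VH 3) \<le> card (VH (l + 4))" using l by (intro order) auto
        ultimately show ?thesis using deg_t l by simp
      qed
    qed
  qed
qed

section \<open>Translation of the degree hypotheses into the bounds \<open>tip\<close> and
  \<open>last\<close>\<close>

theorem theorem2:
  fixes p :: nat and VH :: "nat \<Rightarrow> 'a set" and EH :: "nat \<Rightarrow> 'a set set"
  assumes p: "p = 1 \<or> p = 2"
    and H_graph: "\<And>i. i \<in> {1..3 * p} \<Longrightarrow> simple_graph (VH i) (EH i)"
    and H_conn: "\<And>i. i \<in> {1..3 * p} \<Longrightarrow> connected_graph (VH i) (EH i)"
    and H_size: "\<And>i. i \<in> {1..3 * p} \<Longrightarrow> card (VH i) \<ge> 2"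
    and H_order: "\<And>i. i \<in> {1..<3 * p} \<Longrightarrow> card (VH i) \<le> card (VH (Suc i))"
  shows "(p = 1 \<longrightarrow> antimagic (Gamma_V p VH) (Gamma_E p VH EH))
       \<and> (p = 2
          \<and> (\<forall>i\<in>{1..5}. max_degree (VH i) (EH i) \<le> min_degree (VH (Suc i)) (EH (Suc i)))
          \<and> degree (Gamma_E p VH EH) (Inl (0, 2))
              \<le> Min ((\<lambda>a. degree (Gamma_E p VH EH) (Inr (2, a))) ` VH 2)
          \<and> degree (Gamma_E p VH EH) (Inl (1, 2))
              \<le> Min ((\<lambda>a. degree (Gamma_E p VH EH) (Inr (3, a))) ` VH 3)
          \<and> degree (Gamma_E p VH EH) (Inl (2, 2))
              \<le> Min ((\<lambda>a. degree (Gamma_E p VH EH) (Inr (4, a))) ` VH 4)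
          \<longrightarrow> antimagic (Gamma_V p VH) (Gamma_E p VH EH))"
proof (intro conjI impI)
  assume "p = 1"
  then show "antimagic (Gamma_V p VH) (Gamma_E p VH EH)"
    using antimagic_Gamma_1[of VH EH] H_graph by simp
next
  let ?E = "Gamma_E p VH EH"
  assume "p = 2 \<and> (\<forall>i\<in>{1..5}. max_degree (VH i) (EH i) \<le> min_degree (VH (Suc i)) (EH (Suc i)))
    \<and> degree ?E (Inl (0, 2)) \<le> Min ((\<lambda>a. degree ?E (Inr (2, a))) ` VH 2)
    \<and> degree ?E (Inl (1, 2)) \<le> Min ((\<lambda>a. degree ?E (Inr (3, a))) ` VH 3)
    \<and> degree ?E (Inl (2, 2)) \<le> Min ((\<lambda>a. degree ?E (Inr (4, a))) ` VH 4)"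
  then have p2: "p = 2"
    and chain: "\<And>i. i \<in> {1..5} \<Longrightarrow> max_degree (VH i) (EH i) \<le> min_degree (VH (Suc i)) (EH (Suc i))"
    and tips: "degree ?E (Inl (0, 2)) \<le> Min ((\<lambda>a. degree ?E (Inr (2, a))) ` VH 2)"
      "degree ?E (Inl (1, 2)) \<le> Min ((\<lambda>a. degree ?E (Inr (3, a))) ` VH 3)"
      "degree ?E (Inl (2, 2)) \<le> Min ((\<lambda>a. degree ?E (Inr (4, a))) ` VH 4)"
    by blast+
  have H: "simple_graph (VH i) (EH i)" "2 \<le> card (VH i)" if "i \<in> {1..6}" for i
    using H_graph H_size that p2 by simp_all
  then have fin: "finite (VH i)" if "i \<in> {1..6}" for i
    using that by (simp add: simple_graph_def)
  then have finV: "\<forall>i\<in>{1..6}. finite (VH i)" by blast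
  have nonempty: "VH i \<noteq> {}" if "i \<in> {1..6}" for i
    using H(2)[OF that] by auto
  have order: "card (VH i) \<le> card (VH j)" if "1 \<le> i" "i \<le> j" "j \<le> 6" for i j
    using that(2,3)
  proof (induction j rule: dec_induct)
    case (step j)
    have "card (VH j) \<le> card (VH (Suc j))"
      using H_order[of j] step that(1) p2 by simp
    with step show ?case by simp
  qed simp
  \<comment> \<open>The leg end has degree \<open>card (VH (l + 1)) + 1\<close> in the corona and a
    vertex \<open>a\<close> of copy \<open>l + 2\<close> has its own degree plus 2; one unit
    cancels.\<close>
  have tip: "card (VH (l + 1)) \<le> degree (EH (l + 2)) a + 1" if "l < 3" "a \<in> VH (l + 2)" for l a
  proof -
    have "degree ?E (Inl (l, 2)) \<le> Min ((\<lambda>a. degree ?E (Inr (l + 2, a))) ` VH (l + 2))"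
      using tips that(1) unfolding less_3_cases by (auto simp: numeral_2_eq_2[symmetric])
    also have "\<dots> \<le> degree ?E (Inr (l + 2, a))"
      using that fin[of "l + 2"] by (intro Min_le) auto
    finally show ?thesis
      using degree_Gamma_2(3)[OF finV that(1), where EH = EH]
        degree_Gamma_2_copy[of "l + 2" a VH EH] finite_edges[OF H(1)[of "l + 2"]] that
      unfolding p2 by simp
  qed
  \<comment> \<open>Carries the lower bound from one copy to the next: a vertex \<open>b\<close> of
    copy \<open>i\<close> satisfies it, and every degree in copy \<open>Suc i\<close> is at least
    that of \<open>b\<close>. Starting from copy 4, two applications reach copy 6.\<close>
  have step: "card (VH 3) \<le> degree (EH (Suc i)) a + 1"
    if prems: "i \<in> {1..5}" "\<And>b. b \<in> VH i \<Longrightarrow> card (VH 3) \<le> degree (EH i) b + 1" "a \<in> VH (Suc i)" for i a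
  proof -
    have "VH i \<noteq> {}" using prems(1) by (intro nonempty) auto
    then obtain b where b: "b \<in> VH i" by blast
    have "degree (EH i) b \<le> max_degree (VH i) (EH i)"
      unfolding max_degree_def using fin[of i] prems(1) b by (intro Max_ge) auto
    also have "\<dots> \<le> min_degree (VH (Suc i)) (EH (Suc i))" using chain prems(1) .
    also have "\<dots> \<le> degree (EH (Suc i)) a"
      unfolding min_degree_def using fin[of "Suc i"] prems by (intro Min_le) auto
    finally show ?thesis using prems(2)[OF b] by simp
  qed
  have last4: "card (VH 3) \<le> degree (EH 4) a + 1" if "a \<in> VH 4" for a
    using tip[of 2 a] that by simp
  have last5: "card (VH 3) \<le> degree (EH 5) a + 1" if "a \<in> VH 5" for a
    using step[of 4 a] last4 that by simp
  have last6: "card (VH 3) \<le> degree (EH 6) a + 1" if "a \<in> VH 6" for a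
    using step[of 5 a] last5 that by simp
  have last: "card (VH 3) \<le> degree (EH i) a + 1" if "i \<in> {4..6}" "a \<in> VH i" for i a
  proof -
    have "i = 4 \<or> i = 5 \<or> i = 6" using that(1) by auto
    then show ?thesis using last4 last5 last6 that(2) by auto
  qed
  show "antimagic (Gamma_V p VH) ?E"
    unfolding p2 by (rule antimagic_Gamma_2) (use H nonempty order tip last in auto)
qed

end
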